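(* Let $\Omega(P,V)=(\rightharpoonup,\triangleleft,\vartheta,\cdot_V,\triangleright,f,[-,-]_V)$ be a pre-crossed datum of a Poisson algebra $P$ by a vector space $V$. Then $P\,\sharp\,V$ is a Poisson algebra if and only if the following compatibilities hold for all $p,q,r\in P$ and $x,y\in V$: (P0) $(\rightharpoonup,\triangleleft,\vartheta,\cdot_V)$ is a Hochschild system of the algebra $P$ by $V$, $(\triangleright,f,[-,-]_V)$ is a crossed system of the Lie algebra $P$ by $V$, and $(V,\cdot_V,[-,-]_V)$ is a Poisson algebra; (P1) $f(pq,r)-f(p,r)\triangleleft q-p\rightharpoonup f(q,r)=r\triangleright\vartheta(p,q)+\vartheta([p,r],q)+\vartheta(p,[q,r])$; (P2) $(pq)\triangleright x=p\rightharpoonup(q\triangleright x)+(p\triangleright x)\triangleleft q-[\vartheta(p,q),x]_V$; (P3) $[p,q]\rightharpoonup x=p\rightharpoonup(q\triangleright x)-q\triangleright(p\rightharpoonup x)-f(p,q)\cdot_V x$; (P4) $p\rightharpoonup[x,y]_V=[p\rightharpoonup x,y]_V-(p\triangleright y)\cdot_V x$; (P5) $x\triangleleft[p,q]=(q\triangleright x)\triangleleft p-q\triangleright(x\triangleleft p)-x\cdot_V f(p,q)$; (P6) $[x,y]_V\triangleleft p=[x\triangleleft p,y]_V-x\cdot_V(p\triangleright y)$; (P7) $p\triangleright(x\cdot_V y)=(p\triangleright x)\cdot_V y+x\cdot_V(p\triangleright y)$.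
   Context: $k$ is an arbitrary field; everything is over $k$. Algebras are associative, not necessarily commutative or unital. A Poisson algebra is a vector space $P$ with an associative multiplication $pq$ and a Lie bracket $[-,-]$ such that $[pq,r]=[p,r]q+p[q,r]$ for all $p,q,r\in P$. A pre-crossed datum of $P$ by $V$ is a system $\Omega(P,V)=(\rightharpoonup,\triangleleft,\vartheta,\cdot_V,\triangleright,f,[-,-]_V)$ of seven bilinear maps $\rightharpoonup:P\times V\to V$, $\triangleleft:V\times P\to V$, $\vartheta:P\times P\to V$, $\cdot_V:V\times V\to V$, $\triangleright:P\times V\to V$, $f:P\times P\to V$, $[-,-]_V:V\times V\to V$. $P\,\sharp\,V$ denotes the vector space $P\times V$ with multiplication and bracket $$(p,x)\star(q,y):=(pq,\ \vartheta(p,q)+p\rightharpoonup y+x\triangleleft q+x\cdot_V y),$$ $$\{(p,x),(q,y)\}:=([p,q],\ f(p,q)+p\triangleright y-q\triangleright x+[x,y]_V).$$ $(\rightharpoonup,\triangleleft,\vartheta,\cdot_V)$ is a Hochschild system of the associative algebra $P$ by $V$ if $(P\times V,\star)$ is an associative algebra; equivalently, for all $p,q,r\in P$, $x,y\in V$: $(V,\cdot_V)$ is an associative algebra; $(x\cdot_V y)\triangleleft p=x\cdot_V(y\triangleleft p)$; $(x\triangleleft p)\cdot_V y=x\cdot_V(p\rightharpoonup y)$; $p\rightharpoonup(x\cdot_V y)=(p\rightharpoonup x)\cdot_V y$; $(p\rightharpoonup x)\triangleleft q=p\rightharpoonup(x\triangleleft q)$; $\vartheta(p,q)\triangleleft r=\vartheta(p,qr)-\vartheta(pq,r)+p\rightharpoonup\vartheta(q,r)$;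 $(pq)\rightharpoonup x=p\rightharpoonup(q\rightharpoonup x)-\vartheta(p,q)\cdot_V x$; $x\triangleleft(pq)=(x\triangleleft p)\triangleleft q-x\cdot_V\vartheta(p,q)$. $(\triangleright,f,[-,-]_V)$ is a crossed system of the Lie algebra $P$ by $V$ if $(P\times V,\{-,-\})$ is a Lie algebra; equivalently, for all $p,q,r\in P$, $x,y\in V$: $(V,[-,-]_V)$ is a Lie algebra; $f(p,p)=0$; $p\triangleright[x,y]_V=[p\triangleright x,y]_V+[x,p\triangleright y]_V$; $[p,q]\triangleright x=p\triangleright(q\triangleright x)-q\triangleright(p\triangleright x)+[x,f(p,q)]_V$; $f(p,[q,r])+f(q,[r,p])+f(r,[p,q])+p\triangleright f(q,r)+q\triangleright f(r,p)+r\triangleright f(p,q)=0$. *)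

theory Defs
  imports "HOL-Analysis.Product_Vector"
begin

definition bilinear_map ::
  "('k::field \<Rightarrow> 'a::ab_group_add \<Rightarrow> 'a) \<Rightarrow> ('k \<Rightarrow> 'b::ab_group_add \<Rightarrow> 'b) \<Rightarrow>
   ('k \<Rightarrow> 'c::ab_group_add \<Rightarrow> 'c) \<Rightarrow> ('a \<Rightarrow> 'b \<Rightarrow> 'c) \<Rightarrow> bool"
  where "bilinear_map sA sB sC B \<longleftrightarrow>
    (\<forall>a. Vector_Spaces.linear sB sC (\<lambda>b. B a b)) \<and>
    (\<forall>b. Vector_Spaces.linear sA sC (\<lambda>a. B a b))"

locale associative_algebra = vector_space scale
  for scale :: "'k::field \<Rightarrow> 'a::ab_group_add \<Rightarrow> 'a" +
  fixes mult :: "'a \<Rightarrow> 'a \<Rightarrow> 'a"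
  assumes mult_bilinear: "bilinear_map scale scale scale mult"
    and mult_assoc: "mult (mult a b) c = mult a (mult b c)"

text \<open>The characteristic of the field is arbitrary, so the bracket is required to be
  alternating rather than merely skew-symmetric.\<close>

locale Lie_algebra = vector_space scale
  for scale :: "'k::field \<Rightarrow> 'a::ab_group_add \<Rightarrow> 'a" +
  fixes bracket :: "'a \<Rightarrow> 'a \<Rightarrow> 'a"
  assumes bracket_bilinear: "bilinear_map scale scale scale bracket"
    and bracket_alternating: "bracket a a = 0"
    and Jacobi: "bracket a (bracket b c) + bracket b (bracket c a) + bracket c (bracket a b) = 0"

locale Poisson_algebra = associative_algebra scale mult + Lie_algebra scale bracket
  for scale :: "'k::field \<Rightarrow> 'a::ab_group_add \<Rightarrow> 'a"
    and mult :: "'a \<Rightarrow> 'a \<Rightarrow> 'a"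
    and bracket :: "'a \<Rightarrow> 'a \<Rightarrow> 'a" +
  assumes Leibniz: "bracket (mult a b) c = mult (bracket a c) b + mult a (bracket b c)"

text \<open>The multiplication and the bracket of \<open>P \<sharp> V\<close>. The arguments are the structure
  map of \<open>P\<close> followed by the relevant components of the datum, in the order
  \<open>(\<rightharpoonup>, \<triangleleft>, \<vartheta>, \<cdot>\<^sub>V)\<close> and \<open>(\<triangleright>, f, [-,-]\<^sub>V)\<close> respectively.\<close>

definition sharp_mult ::
  "('p \<Rightarrow> 'p \<Rightarrow> 'p) \<Rightarrow>
   ('p \<Rightarrow> 'v \<Rightarrow> 'v) \<Rightarrow> ('v \<Rightarrow> 'p \<Rightarrow> 'v) \<Rightarrow> ('p \<Rightarrow> 'p \<Rightarrow> 'v) \<Rightarrow> ('v \<Rightarrow> 'v \<Rightarrow> 'v) \<Rightarrow>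
   'p \<times> 'v \<Rightarrow> 'p \<times> 'v \<Rightarrow> 'p \<times> 'v::ab_group_add"
  where "sharp_mult multP lact ract theta multV = (\<lambda>(p, x) (q, y).
    (multP p q, theta p q + lact p y + ract x q + multV x y))"

definition sharp_bracket ::
  "('p \<Rightarrow> 'p \<Rightarrow> 'p) \<Rightarrow>
   ('p \<Rightarrow> 'v \<Rightarrow> 'v) \<Rightarrow> ('p \<Rightarrow> 'p \<Rightarrow> 'v) \<Rightarrow> ('v \<Rightarrow> 'v \<Rightarrow> 'v) \<Rightarrow>
   'p \<times> 'v \<Rightarrow> 'p \<times> 'v \<Rightarrow> 'p \<times> 'v::ab_group_add"
  where "sharp_bracket bracketP act f bracketV = (\<lambda>(p, x) (q, y).
    (bracketP p q, f p q + act p y - act q x + bracketV x y))"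

locale pre_crossed_datum =
  P: Poisson_algebra scaleP multP bracketP + V: vector_space scaleV
  for scaleP :: "'k::field \<Rightarrow> 'p::ab_group_add \<Rightarrow> 'p"
    and multP :: "'p \<Rightarrow> 'p \<Rightarrow> 'p"
    and bracketP :: "'p \<Rightarrow> 'p \<Rightarrow> 'p"
    and scaleV :: "'k \<Rightarrow> 'v::ab_group_add \<Rightarrow> 'v" +
  fixes lact :: "'p \<Rightarrow> 'v \<Rightarrow> 'v"
    and ract :: "'v \<Rightarrow> 'p \<Rightarrow> 'v"
    and theta :: "'p \<Rightarrow> 'p \<Rightarrow> 'v"
    and multV :: "'v \<Rightarrow> 'v \<Rightarrow> 'v"
    and act :: "'p \<Rightarrow> 'v \<Rightarrow> 'v"
    and f :: "'p \<Rightarrow> 'p \<Rightarrow> 'v"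
    and bracketV :: "'v \<Rightarrow> 'v \<Rightarrow> 'v"
  assumes lact_bilinear: "bilinear_map scaleP scaleV scaleV lact"
    and ract_bilinear: "bilinear_map scaleV scaleP scaleV ract"
    and theta_bilinear: "bilinear_map scaleP scaleP scaleV theta"
    and multV_bilinear: "bilinear_map scaleV scaleV scaleV multV"
    and act_bilinear: "bilinear_map scaleP scaleV scaleV act"
    and f_bilinear: "bilinear_map scaleP scaleP scaleV f"
    and bracketV_bilinear: "bilinear_map scaleV scaleV scaleV bracketV"

definition Hochschild_system ::
  "('k::field \<Rightarrow> 'p::ab_group_add \<Rightarrow> 'p) \<Rightarrow> ('p \<Rightarrow> 'p \<Rightarrow> 'p) \<Rightarrow> ('k \<Rightarrow> 'v::ab_group_add \<Rightarrow> 'v) \<Rightarrow>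
   ('p \<Rightarrow> 'v \<Rightarrow> 'v) \<Rightarrow> ('v \<Rightarrow> 'p \<Rightarrow> 'v) \<Rightarrow> ('p \<Rightarrow> 'p \<Rightarrow> 'v) \<Rightarrow> ('v \<Rightarrow> 'v \<Rightarrow> 'v) \<Rightarrow> bool"
  where "Hochschild_system scaleP multP scaleV lact ract theta multV \<longleftrightarrow>
    associative_algebra (module_prod.scale scaleP scaleV) (sharp_mult multP lact ract theta multV)"

definition Lie_crossed_system ::
  "('k::field \<Rightarrow> 'p::ab_group_add \<Rightarrow> 'p) \<Rightarrow> ('p \<Rightarrow> 'p \<Rightarrow> 'p) \<Rightarrow> ('k \<Rightarrow> 'v::ab_group_add \<Rightarrow> 'v) \<Rightarrow>
   ('p \<Rightarrow> 'v \<Rightarrow> 'v) \<Rightarrow> ('p \<Rightarrow> 'p \<Rightarrow> 'v) \<Rightarrow> ('v \<Rightarrow> 'v \<Rightarrow> 'v) \<Rightarrow> bool"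
  where "Lie_crossed_system scaleP bracketP scaleV act f bracketV \<longleftrightarrow>
    Lie_algebra (module_prod.scale scaleP scaleV) (sharp_bracket bracketP act f bracketV)"

lemma bilinear_map_simps:
  assumes "bilinear_map sA sB sC B"
  shows "B (a + a') b = B a b + B a' b" "B a (b + b') = B a b + B a b'"
    "B (a - a') b = B a b - B a' b" "B a (b - b') = B a b - B a b'"
    "B (sA c a) b = sC c (B a b)" "B a (sB c b) = sC c (B a b)"
    "B 0 b = 0" "B a 0 = 0" "B (- a) b = - B a b" "B a (- b) = - B a b"
proof -
  interpret r: Vector_Spaces.linear sB sC "\<lambda>b. B a b" for a
    using assms by (simp add: bilinear_map_def)
  interpret l: Vector_Spaces.linear sA sC "\<lambda>a. B a b" for b
    using assms by (simp add: bilinear_map_def)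
  show "B (a + a') b = B a b + B a' b" "B a (b + b') = B a b + B a b'"
    "B (a - a') b = B a b - B a' b" "B a (b - b') = B a b - B a b'"
    "B (sA c a) b = sC c (B a b)" "B a (sB c b) = sC c (B a b)"
    "B 0 b = 0" "B a 0 = 0" "B (- a) b = - B a b" "B a (- b) = - B a b"
    by (fact l.add r.add l.diff r.diff l.scale r.scale l.zero r.zero l.neg r.neg)+
qed

lemma bilinear_mapI:
  assumes "vector_space sA" "vector_space sB" "vector_space sC"
    and "\<And>a a' b. B (a + a') b = B a b + B a' b" "\<And>a b b'. B a (b + b') = B a b + B a b'"
    and "\<And>c a b. B (sA c a) b = sC c (B a b)" "\<And>c a b. B a (sB c b) = sC c (B a b)"
  shows "bilinear_map sA sB sC B"
  using assms by (simp add: bilinear_map_def Vector_Spaces.linear_iff)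

context pre_crossed_datum
begin

sublocale PV: vector_space_prod scaleP scaleV
  by unfold_locales

lemmas datum_simps =
  bilinear_map_simps[OF P.mult_bilinear] bilinear_map_simps[OF P.bracket_bilinear]
  bilinear_map_simps[OF lact_bilinear] bilinear_map_simps[OF ract_bilinear]
  bilinear_map_simps[OF theta_bilinear] bilinear_map_simps[OF multV_bilinear]
  bilinear_map_simps[OF act_bilinear] bilinear_map_simps[OF f_bilinear]
  bilinear_map_simps[OF bracketV_bilinear]

lemma sharp_mult_bilinear:
  "bilinear_map PV.scale PV.scale PV.scale (sharp_mult multP lact ract theta multV)"
  by (rule bilinear_mapI)
    (auto simp: PV.p.vector_space_axioms sharp_mult_def PV.scale_def datum_simps
      V.scale_right_distrib split: prod.splits)

lemma sharp_bracket_bilinear: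
  "bilinear_map PV.scale PV.scale PV.scale (sharp_bracket bracketP act f bracketV)"
  by (rule bilinear_mapI)
    (auto simp: PV.p.vector_space_axioms sharp_bracket_def PV.scale_def datum_simps
      V.scale_right_distrib V.scale_right_diff_distrib split: prod.splits)

text \<open>For a pre-crossed datum, \<^const>\<open>Hochschild_system\<close> and
  \<^const>\<open>Lie_crossed_system\<close> amount to the usual lists of identities.\<close>

lemma Hochschild_system_iff:
  "Hochschild_system scaleP multP scaleV lact ract theta multV \<longleftrightarrow>
    associative_algebra scaleV multV \<and>
    (\<forall>p x y. ract (multV x y) p = multV x (ract y p)) \<and>
    (\<forall>p x y. multV (ract x p) y = multV x (lact p y)) \<and>
    (\<forall>p x y. lact p (multV x y) = multV (lact p x) y) \<and>
    (\<forall>p q x. ract (lact p x) q = lact p (ract x q)) \<and>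
    (\<forall>p q r. ract (theta p q) r = theta p (multP q r) - theta (multP p q) r + lact p (theta q r)) \<and>
    (\<forall>p q x. lact (multP p q) x = lact p (lact q x) - multV (theta p q) x) \<and>
    (\<forall>p q x. ract x (multP p q) = ract (ract x p) q - multV x (theta p q))"
  (is "?H \<longleftrightarrow> ?E")
proof
  let ?m = "sharp_mult multP lact ract theta multV"
  assume ?H
  then interpret H: associative_algebra PV.scale ?m
    by (simp add: Hochschild_system_def)
  have *: "?m (?m (p, x) (q, y)) (r, z) = ?m (p, x) (?m (q, y) (r, z))" for p x q y r z
    by (rule H.mult_assoc)
  have "associative_algebra scaleV multV"
    using *[of 0 _ 0 _ 0] by unfold_locales (simp_all add: multV_bilinear sharp_mult_def datum_simps)
  moreover have "\<forall>p x y. ract (multV x y) p = multV x (ract y p)"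
    using *[of 0 _ 0 _ _ 0] by (simp add: sharp_mult_def datum_simps)
  moreover have "\<forall>p x y. multV (ract x p) y = multV x (lact p y)"
    using *[of 0 _ _ 0 0 _] by (simp add: sharp_mult_def datum_simps)
  moreover have "\<forall>p x y. lact p (multV x y) = multV (lact p x) y"
    using *[of _ 0 0 _ 0 _] by (simp add: sharp_mult_def datum_simps)
  moreover have "\<forall>p q x. ract (lact p x) q = lact p (ract x q)"
    using *[of _ 0 0 _ _ 0] by (simp add: sharp_mult_def datum_simps)
  moreover have "\<forall>p q r. ract (theta p q) r
      = theta p (multP q r) - theta (multP p q) r + lact p (theta q r)"
    using *[of _ 0 _ 0 _ 0] by (simp add: sharp_mult_def datum_simps algebra_simps)
  moreover have "\<forall>p q x. lact (multP p q) x = lact p (lact q x) - multV (theta p q) x"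
    using *[of _ 0 _ 0 0 _] by (simp add: sharp_mult_def datum_simps algebra_simps)
  moreover have "\<forall>p q x. ract x (multP p q) = ract (ract x p) q - multV x (theta p q)"
    using *[of 0 _ _ 0 _ 0] by (simp add: sharp_mult_def datum_simps algebra_simps)
  ultimately show ?E by blast
next
  assume E: ?E
  then interpret VA: associative_algebra scaleV multV by blast
  have "associative_algebra PV.scale (sharp_mult multP lact ract theta multV)"
  proof unfold_locales
    fix a b c :: "'p \<times> 'v"
    show "sharp_mult multP lact ract theta multV (sharp_mult multP lact ract theta multV a b) c
      = sharp_mult multP lact ract theta multV a (sharp_mult multP lact ract theta multV b c)"
      using E by (cases a; cases b; cases c)
        (simp add: sharp_mult_def datum_simps P.mult_assoc VA.mult_assoc)
  qed (rule sharp_mult_bilinear)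
  then show ?H by (simp add: Hochschild_system_def)
qed

lemma Lie_crossed_system_iff:
  "Lie_crossed_system scaleP bracketP scaleV act f bracketV \<longleftrightarrow>
    Lie_algebra scaleV bracketV \<and>
    (\<forall>p. f p p = 0) \<and>
    (\<forall>p x y. act p (bracketV x y) = bracketV (act p x) y + bracketV x (act p y)) \<and>
    (\<forall>p q x. act (bracketP p q) x = act p (act q x) - act q (act p x) + bracketV x (f p q)) \<and>
    (\<forall>p q r. f p (bracketP q r) + f q (bracketP r p) + f r (bracketP p q)
       + act p (f q r) + act q (f r p) + act r (f p q) = 0)"
  (is "?L \<longleftrightarrow> ?E")
proof
  let ?b = "sharp_bracket bracketP act f bracketV"
  assume ?L
  then interpret L: Lie_algebra PV.scale ?b
    by (simp add: Lie_crossed_system_def)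
  have alt: "?b (p, x) (p, x) = 0" for p x
    by (rule L.bracket_alternating)
  have "?b (p, x) (?b (q, y) (r, z)) + ?b (q, y) (?b (r, z) (p, x))
      + ?b (r, z) (?b (p, x) (q, y)) = 0" for p x q y r z
    by (rule L.Jacobi)
  note jac = this
  have altV: "bracketV x x = 0" for x
    using alt[of 0 x] by (simp add: sharp_bracket_def zero_prod_def datum_simps)
  have skewV: "bracketV y x = - bracketV x y" for x y
    using altV[of "x + y", unfolded datum_simps, unfolded altV]
    by (simp add: eq_neg_iff_add_eq_0 add.commute)
  have altf: "f p p = 0" for p
    using alt[of p 0] by (simp add: sharp_bracket_def zero_prod_def datum_simps)
  have "Lie_algebra scaleV bracketV"
    using jac[of 0 _ 0 _ 0] by unfold_locales (simp_all add: bracketV_bilinear altV sharp_bracket_def zero_prod_def datum_simps)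
  moreover have "\<forall>p x y. act p (bracketV x y) = bracketV (act p x) y + bracketV x (act p y)"
  proof (intro allI)
    fix p x y
    show "act p (bracketV x y) = bracketV (act p x) y + bracketV x (act p y)"
      using jac[of p 0 0 x 0 y] skewV[of y "act p x"]
      by (simp add: sharp_bracket_def zero_prod_def datum_simps algebra_simps)
  qed
  moreover have "\<forall>p q x. act (bracketP p q) x
      = act p (act q x) - act q (act p x) + bracketV x (f p q)"
    using jac[of _ 0 _ 0 0 _] by (simp add: sharp_bracket_def zero_prod_def datum_simps algebra_simps)
  moreover have "\<forall>p q r. f p (bracketP q r) + f q (bracketP r p) + f r (bracketP p q)
       + act p (f q r) + act q (f r p) + act r (f p q) = 0"
    using jac[of _ 0 _ 0 _ 0] by (simp add: sharp_bracket_def zero_prod_def datum_simps algebra_simps)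
  ultimately show ?E using altf by blast
next
  assume E: ?E
  then interpret VL: Lie_algebra scaleV bracketV by blast
  have skewV: "bracketV y x = - bracketV x y" for x y
    using VL.bracket_alternating[of "x + y", unfolded datum_simps, unfolded VL.bracket_alternating]
    by (simp add: eq_neg_iff_add_eq_0 add.commute)
  have act_bracketV: "act p (bracketV x y) = bracketV (act p x) y + bracketV x (act p y)"
    and act_bracketP: "act (bracketP p q) x = act p (act q x) - act q (act p x) + bracketV x (f p q)"
    for p q x y
    using E by blast+
  have "Lie_algebra PV.scale (sharp_bracket bracketP act f bracketV)"
  proof unfold_locales
    fix a b c :: "'p \<times> 'v"
    show "sharp_bracket bracketP act f bracketV a a = 0"
      using E by (cases a) (simp add: sharp_bracket_def zero_prod_def
          P.bracket_alternating VL.bracket_alternating)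
    obtain p x q y r z where abc: "a = (p, x)" "b = (q, y)" "c = (r, z)"
      by (cases a; cases b; cases c)
    have fc: "f p (bracketP q r) = - f q (bracketP r p) - f r (bracketP p q)
        - act p (f q r) - act q (f r p) - act r (f p q)"
      using E by (simp add: algebra_simps eq_neg_iff_add_eq_0)
    have JV: "bracketV x (bracketV y z) = - bracketV y (bracketV z x) - bracketV z (bracketV x y)"
      using VL.Jacobi[of x y z] by (simp add: algebra_simps eq_neg_iff_add_eq_0)
    have JP: "bracketP p (bracketP q r) = - bracketP q (bracketP r p) - bracketP r (bracketP p q)"
      using P.Jacobi[of p q r] by (simp add: algebra_simps eq_neg_iff_add_eq_0)
    show "sharp_bracket bracketP act f bracketV a (sharp_bracket bracketP act f bracketV b c)
      + sharp_bracket bracketP act f bracketV b (sharp_bracket bracketP act f bracketV c a)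
      + sharp_bracket bracketP act f bracketV c (sharp_bracket bracketP act f bracketV a b) = 0"
      by (simp add: abc sharp_bracket_def zero_prod_def datum_simps act_bracketV act_bracketP
          JP JV fc skewV[of "act p z" y] skewV[of "act p y" z] skewV[of "act q z" x]
          skewV[of "act q x" z] skewV[of "act r y" x] skewV[of "act r x" y] algebra_simps)
  qed (rule sharp_bracket_bilinear)
  then show ?L by (simp add: Lie_crossed_system_def)
qed

end

end

theory Submission
  imports Defs
begin

text \<open>The associative and the Lie axioms of \<open>P \<sharp> V\<close> are by definition the
  Hochschild system and the Lie crossed system, so everything rests on the Leibniz law. Its defect
  \<open>{a \<star> b, c} - {a, c} \<star> b - a \<star> {b, c}\<close> is trilinear, hence vanishes identically
  as soon as it vanishes on triples whose entries each lie in \<open>P \<times> 0\<close> or in \<open>0 \<times> V\<close>.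
  There are eight kinds of such triples. On each of them the \<open>P\<close>-component of the
  defect vanishes because \<open>P\<close> is a Poisson algebra, and the \<open>V\<close>-component is, up to sign, the
  difference of the two sides of exactly one identity: with three entries from \<open>P\<close> it is the
  relation between \<open>f\<close> and \<open>\<vartheta>\<close>, with three from \<open>V\<close> the Leibniz law of \<open>V\<close>, and the six
  mixed kinds give the six compatibilities of the actions with the products and the brackets.
  This is the lemma \<open>sharp_Leibniz_iff\<close>. The remaining axioms of a Poisson algebra on \<open>V\<close>
  are contained in the Hochschild and Lie crossed systems, since \<open>0 \<times> V\<close> is closed under both
  operations of \<open>P \<sharp> V\<close>.\<close>

context pre_crossed_datum
begin

abbreviation sharp_mult_op (infixl "\<star>" 75)
  where "a \<star> b \<equiv> sharp_mult multP lact ract theta multV a b"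

abbreviation sharp_bracket_op ("\<lbrace>_, _\<rbrace>")
  where "\<lbrace>a, b\<rbrace> \<equiv> sharp_bracket bracketP act f bracketV a b"

text \<open>Evaluating the law on entries \<open>(p, 0)\<close> and \<open>(0, x)\<close> isolates one identity at a time.
  Conversely, each identity expands one of the operations at an argument that is itself a product
  or a bracket; once all such terms are expanded, both sides of the law consist of
  the same summands.\<close>

lemma sharp_Leibniz_iff:
  "(\<forall>a b c. \<lbrace>a \<star> b, c\<rbrace> = \<lbrace>a, c\<rbrace> \<star> b + a \<star> \<lbrace>b, c\<rbrace>) \<longleftrightarrow>
    (\<forall>x y z. bracketV (multV x y) z = multV (bracketV x z) y + multV x (bracketV y z)) \<and>
    (\<forall>p q r. f (multP p q) r - ract (f p r) q - lact p (f q r)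
      = act r (theta p q) + theta (bracketP p r) q + theta p (bracketP q r)) \<and>
    (\<forall>p q x. act (multP p q) x
      = lact p (act q x) + ract (act p x) q - bracketV (theta p q) x) \<and>
    (\<forall>p q x. lact (bracketP p q) x
      = lact p (act q x) - act q (lact p x) - multV (f p q) x) \<and>
    (\<forall>p x y. lact p (bracketV x y) = bracketV (lact p x) y - multV (act p y) x) \<and>
    (\<forall>p q x. ract x (bracketP p q)
      = ract (act q x) p - act q (ract x p) - multV x (f p q)) \<and>
    (\<forall>p x y. ract (bracketV x y) p = bracketV (ract x p) y - multV x (act p y)) \<and>
    (\<forall>p x y. act p (multV x y) = multV (act p x) y + multV x (act p y))"
  (is "?L \<longleftrightarrow> ?E")
proof
  assume ?L
  then have law: "\<lbrace>(p, x) \<star> (q, y), (r, z)\<rbrace>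
      = \<lbrace>(p, x), (r, z)\<rbrace> \<star> (q, y) + (p, x) \<star> \<lbrace>(q, y), (r, z)\<rbrace>" for p x q y r z
    by blast
  note expand = sharp_mult_def sharp_bracket_def datum_simps
  show ?E
  proof (intro conjI allI)
    fix x y z
    show "bracketV (multV x y) z = multV (bracketV x z) y + multV x (bracketV y z)"
      using law[of 0 x 0 y 0 z] by (simp add: expand)
  next
    fix p q r
    show "f (multP p q) r - ract (f p r) q - lact p (f q r)
        = act r (theta p q) + theta (bracketP p r) q + theta p (bracketP q r)"
      using law[of p 0 q 0 r 0] by (simp add: expand algebra_simps)
  next
    fix p q x
    show "act (multP p q) x
        = lact p (act q x) + ract (act p x) q - bracketV (theta p q) x"
      using law[of p 0 q 0 0 x] by (simp add: expand algebra_simps)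
  next
    fix p q x
    show "lact (bracketP p q) x
        = lact p (act q x) - act q (lact p x) - multV (f p q) x"
      using law[of p 0 0 x q 0] by (simp add: expand algebra_simps)
  next
    fix p x y
    show "lact p (bracketV x y) = bracketV (lact p x) y - multV (act p y) x"
      using law[of p 0 0 x 0 y] by (simp add: expand algebra_simps)
  next
    fix p q x
    show "ract x (bracketP p q)
        = ract (act q x) p - act q (ract x p) - multV x (f p q)"
      using law[of 0 x p 0 q 0] by (simp add: expand algebra_simps)
  next
    fix p x y
    show "ract (bracketV x y) p = bracketV (ract x p) y - multV x (act p y)"
      using law[of 0 x p 0 0 y] by (simp add: expand algebra_simps)
  next
    fix p x y
    show "act p (multV x y) = multV (act p x) y + multV x (act p y)"
      using law[of 0 x 0 y p 0] by (simp add: expand algebra_simps)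
  qed
next
  assume E: ?E
  show ?L
  proof (intro allI)
    fix a b c :: "'p \<times> 'v"
    obtain p x q y r z where abc: "a = (p, x)" "b = (q, y)" "c = (r, z)"
      by (cases a; cases b; cases c)
    \<comment> \<open>The first term is isolated because a difference on the left would not match
      the summands of the expanded law.\<close>
    have f_multP: "f (multP p q) r = ract (f p r) q + lact p (f q r)
        + act r (theta p q) + theta (bracketP p r) q + theta p (bracketP q r)"
      using E by (simp add: algebra_simps)
    show "\<lbrace>a \<star> b, c\<rbrace> = \<lbrace>a, c\<rbrace> \<star> b + a \<star> \<lbrace>b, c\<rbrace>"
      using E by (simp add: abc sharp_mult_def sharp_bracket_def datum_simps P.Leibniz f_multP)
  qed
qed

end

theorem theorem2p2:
  fixes scaleP :: "'k::field \<Rightarrow> 'p::ab_group_add \<Rightarrow> 'p"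
    and multP :: "'p \<Rightarrow> 'p \<Rightarrow> 'p"  (infixl "\<cdot>\<^sub>P" 75)
    and bracketP :: "'p \<Rightarrow> 'p \<Rightarrow> 'p"  ("[_, _]\<^sub>P")
    and scaleV :: "'k \<Rightarrow> 'v::ab_group_add \<Rightarrow> 'v"
    and lact :: "'p \<Rightarrow> 'v \<Rightarrow> 'v"  (infixr "\<rightharpoonup>" 75)
    and ract :: "'v \<Rightarrow> 'p \<Rightarrow> 'v"  (infixl "\<triangleleft>" 75)
    and theta :: "'p \<Rightarrow> 'p \<Rightarrow> 'v"  ("\<vartheta>")
    and multV :: "'v \<Rightarrow> 'v \<Rightarrow> 'v"  (infixl "\<cdot>\<^sub>V" 75)
    and act :: "'p \<Rightarrow> 'v \<Rightarrow> 'v"  (infixr "\<triangleright>" 75)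
    and f :: "'p \<Rightarrow> 'p \<Rightarrow> 'v"
    and bracketV :: "'v \<Rightarrow> 'v \<Rightarrow> 'v"  ("[_, _]\<^sub>V")
  assumes "pre_crossed_datum scaleP multP bracketP scaleV lact ract theta multV act f bracketV"
  shows "Poisson_algebra (module_prod.scale scaleP scaleV)
           (sharp_mult multP lact ract theta multV) (sharp_bracket bracketP act f bracketV)
    \<longleftrightarrow>
      \<comment> \<open>(P0)\<close>
      (Hochschild_system scaleP multP scaleV lact ract theta multV \<and>
       Lie_crossed_system scaleP bracketP scaleV act f bracketV \<and>
       Poisson_algebra scaleV multV bracketV) \<and>
      \<comment> \<open>(P1)\<close>
      (\<forall>p q r. f (p \<cdot>\<^sub>P q) r - (f p r) \<triangleleft> q - p \<rightharpoonup> (f q r)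
                = r \<triangleright> (\<vartheta> p q) + \<vartheta> [p, r]\<^sub>P q + \<vartheta> p [q, r]\<^sub>P) \<and>
      \<comment> \<open>(P2)\<close>
      (\<forall>p q x. (p \<cdot>\<^sub>P q) \<triangleright> x = p \<rightharpoonup> (q \<triangleright> x) + (p \<triangleright> x) \<triangleleft> q - [\<vartheta> p q, x]\<^sub>V) \<and>
      \<comment> \<open>(P3)\<close>
      (\<forall>p q x. [p, q]\<^sub>P \<rightharpoonup> x = p \<rightharpoonup> (q \<triangleright> x) - q \<triangleright> (p \<rightharpoonup> x) - (f p q) \<cdot>\<^sub>V x) \<and>
      \<comment> \<open>(P4)\<close>
      (\<forall>p x y. p \<rightharpoonup> [x, y]\<^sub>V = [p \<rightharpoonup> x, y]\<^sub>V - (p \<triangleright> y) \<cdot>\<^sub>V x) \<and>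
      \<comment> \<open>(P5)\<close>
      (\<forall>p q x. x \<triangleleft> [p, q]\<^sub>P = (q \<triangleright> x) \<triangleleft> p - q \<triangleright> (x \<triangleleft> p) - x \<cdot>\<^sub>V (f p q)) \<and>
      \<comment> \<open>(P6)\<close>
      (\<forall>p x y. [x, y]\<^sub>V \<triangleleft> p = [x \<triangleleft> p, y]\<^sub>V - x \<cdot>\<^sub>V (p \<triangleright> y)) \<and>
      \<comment> \<open>(P7)\<close>
      (\<forall>p x y. p \<triangleright> (x \<cdot>\<^sub>V y) = (p \<triangleright> x) \<cdot>\<^sub>V y + x \<cdot>\<^sub>V (p \<triangleright> y))"
proof -
  interpret pre_crossed_datum scaleP multP bracketP scaleV lact ract theta multV act f bracketV
    by (fact assms)
  have sharp: "Poisson_algebra PV.scale (sharp_mult multP lact ract theta multV)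
        (sharp_bracket bracketP act f bracketV) \<longleftrightarrow>
      Hochschild_system scaleP multP scaleV lact ract theta multV \<and>
      Lie_crossed_system scaleP bracketP scaleV act f bracketV \<and>
      (\<forall>a b c. \<lbrace>a \<star> b, c\<rbrace> = \<lbrace>a, c\<rbrace> \<star> b + a \<star> \<lbrace>b, c\<rbrace>)"
    by (simp add: Poisson_algebra_def Poisson_algebra_axioms_def Hochschild_system_def
        Lie_crossed_system_def)
  have V: "Poisson_algebra scaleV multV bracketV \<longleftrightarrow>
      (\<forall>x y z. bracketV (multV x y) z = multV (bracketV x z) y + multV x (bracketV y z))"
    if "Hochschild_system scaleP multP scaleV lact ract theta multV"
      "Lie_crossed_system scaleP bracketP scaleV act f bracketV"
    using that unfolding Hochschild_system_iff Lie_crossed_system_iff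
    by (simp add: Poisson_algebra_def Poisson_algebra_axioms_def)
  show ?thesis
    unfolding sharp sharp_Leibniz_iff by (simp only: V conj_assoc cong: conj_cong)
qed

end
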